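(* For positive integers $\lambda_1,\ldots,\lambda_r$ (with $r\ge1$), $$\mathrm{AO}(K_{\lambda_1,\ldots,\lambda_r})=\int_0^\infty e^{-t}\prod_{i=1}^r P_{\lambda_i}(t)\,dt .$$
   Context: $\mathrm{AO}(G)$ is the number of acyclic orientations of a graph $G$. $K_{\lambda_1,\ldots,\lambda_r}$ is the complete multipartite graph with parts of sizes $\lambda_1,\ldots,\lambda_r$ (for $r=1$, the edgeless graph). For $m\ge1$, $$P_m(t)=\sum_{j=1}^m(-1)^{m+j}S(m,j)t^j,$$ where $S(m,j)$ is the Stirling number of the second kind. *)

theory Defs
  imports "HOL-Analysis.Analysis" "HOL-Combinatorics.Stirling"
begin

text \<open>A simple graph is a pair \<open>(V, E)\<close> of a vertex set and a set of two-element subsets of \<open>V\<close>.\<close>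

type_synonym 'a ugraph = "'a set \<times> 'a set set"

text \<open>The vertex \<open>(i, k)\<close> is the \<open>k\<close>-th vertex of the \<open>i\<close>-th part.\<close>

definition multipartite_verts :: "nat \<Rightarrow> (nat \<Rightarrow> nat) \<Rightarrow> (nat \<times> nat) set" where
  "multipartite_verts r lam = (SIGMA i:{1..r}. {1..lam i})"

definition complete_multipartite :: "nat \<Rightarrow> (nat \<Rightarrow> nat) \<Rightarrow> (nat \<times> nat) ugraph" where
  "complete_multipartite r lam =
     (multipartite_verts r lam,
      {{u, v} | u v. u \<in> multipartite_verts r lam \<and> v \<in> multipartite_verts r lam \<and> fst u \<noteq> fst v})"

text \<open>An orientation is given by its set of arcs: exactly one of \<open>(u, v)\<close> and \<open>(v, u)\<close> for
  each edge \<open>{u, v}\<close>, and no other arcs.\<close>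

definition orientations :: "'a ugraph \<Rightarrow> ('a \<times> 'a) set set" where
  "orientations G = {A. (\<forall>(u, v) \<in> A. {u, v} \<in> snd G) \<and>
     (\<forall>u v. {u, v} \<in> snd G \<longrightarrow> ((u, v) \<in> A \<longleftrightarrow> (v, u) \<notin> A))}"

definition AO :: "'a ugraph \<Rightarrow> nat" where
  "AO G = card {A \<in> orientations G. acyclic A}"

definition P :: "nat \<Rightarrow> real \<Rightarrow> real" where
  "P m t = (\<Sum>j = 1..m. (-1) ^ (m + j) * real (Stirling m j) * t ^ j)"

end

theory Submission
  imports Defs "HOL-Computational_Algebra.Polynomial"
begin

text \<open>
  The sources of an acyclic orientation form a nonempty independent set, and deleting an independent
  set \<open>I\<close> of vertices is a bijection from the acyclic orientations whose sources include \<open>I\<close> to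
  those of \<open>G - I\<close>. By inclusion-exclusion, \<open>\<Sum>\<^sub>I (-1)\<^bsup>|I|\<^esup> AO (G - I) = 0\<close> over the independent
  sets \<open>I\<close> of a nonempty graph. The independent sets of a complete multipartite graph are the subsets
  of single parts. The integrals satisfy the same recursion: since
  \<open>P\<^sub>m' = \<Sum>\<^bsub>k\<ge>1\<^esub> (-1)\<^bsup>k+1\<^esup> (m choose k) P\<^bsub>m-k\<^esub>\<close> with \<open>P\<^sub>0 = 1\<close>, it is the integration by parts
  \<open>\<integral> e\<^bsup>-t\<^esup> F = F(0) + \<integral> e\<^bsup>-t\<^esup> F'\<close> for the product \<open>F\<close> of the polynomials of the parts, where
  \<open>F(0) = 0\<close> as some part is nonempty.
\<close>

section \<open>Sums over the subsets of a finite set\<close>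

lemma sum_Pow_alternating:
  assumes "finite S" "S \<noteq> {}"
  shows "(\<Sum>I\<in>Pow S. (- 1) ^ card I) = (0 :: 'a :: comm_ring_1)"
proof -
  \<comment> \<open>Expanding the product, the subset \<open>I\<close> records the factors from
    which -1 is taken.\<close>
  have "(\<Sum>I\<in>Pow S. (- 1) ^ card I) = (\<Prod>x\<in>S. - 1 + (1 :: 'a))"
    by (subst prod_add[OF assms(1)]) simp
  then show ?thesis using assms by (simp add: zero_power card_gt_0_iff)
qed

lemma sum_Pow_card:
  fixes g :: "nat \<Rightarrow> 'a :: comm_semiring_1"
  assumes "finite S"
  shows "(\<Sum>I\<in>Pow S. g (card I)) = (\<Sum>k\<le>card S. of_nat (card S choose k) * g k)"
proof -
  have "(\<Sum>I\<in>Pow S. g (card I)) = (\<Sum>k\<le>card S. \<Sum>I\<in>{I \<in> Pow S. card I = k}. g (card I))"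
    using assms by (subst sum.group) (auto simp: card_mono)
  also have "\<dots> = (\<Sum>k\<le>card S. \<Sum>I\<in>{I \<in> Pow S. card I = k}. g k)"
    by (intro sum.cong) auto
  also have "\<dots> = (\<Sum>k\<le>card S. of_nat (card S choose k) * g k)"
    using n_subsets[OF assms] by simp
  finally show ?thesis .
qed


subsection \<open>Acyclic orientations with prescribed sources\<close>

definition acyclic_orientations :: "'a ugraph \<Rightarrow> ('a \<times> 'a) set set" where
  "acyclic_orientations G = {A \<in> orientations G. acyclic A}"

text \<open>The vertex set is a separate argument because isolated vertices, which count as sources,
  leave no trace in \<open>A\<close>.\<close>

definition sources :: "'a set \<Rightarrow> ('a \<times> 'a) set \<Rightarrow> 'a set" where
  "sources W A = {v \<in> W. \<forall>u. (u, v) \<notin> A}"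

definition induced :: "'a ugraph \<Rightarrow> 'a set \<Rightarrow> 'a ugraph" where
  "induced G U = (U, {e \<in> snd G. e \<subseteq> U})"

definition indep :: "'a ugraph \<Rightarrow> 'a set \<Rightarrow> bool" where
  "indep G I \<longleftrightarrow> (\<forall>u\<in>I. \<forall>v\<in>I. {u, v} \<notin> snd G)"

lemma orientations_subset:
  assumes "\<Union> (snd G) \<subseteq> fst G" "A \<in> orientations G"
  shows "A \<subseteq> fst G \<times> fst G"
proof (rule subrelI)
  fix u v assume "(u, v) \<in> A"
  then have "{u, v} \<in> snd G" using assms(2) by (auto simp: orientations_def)
  then show "(u, v) \<in> fst G \<times> fst G" using assms(1) by auto
qed

text \<open>An edge joining two sources would have to be an arc into one of them.\<close>

lemma indep_subset_sources:
  assumes "A \<in> orientations G" "I \<subseteq> sources W A"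
  shows "indep G I"
  unfolding indep_def
proof (intro ballI notI)
  fix u v assume "u \<in> I" "v \<in> I" and e: "{u, v} \<in> snd G"
  then have "(u, v) \<notin> A" "(v, u) \<notin> A"
    using assms(2) by (auto simp: sources_def)
  moreover have "(u, v) \<in> A \<longleftrightarrow> (v, u) \<notin> A"
    using assms(1) e by (simp add: orientations_def)
  ultimately show False by simp
qed

lemma sources_nonempty:
  assumes "finite W" "W \<noteq> {}" "acyclic A" "A \<subseteq> W \<times> W"
  shows "sources W A \<noteq> {}"
proof -
  have "wf A"
    using assms finite_subset by (blast intro: finite_acyclic_wf)
  then obtain v where "v \<in> W" "\<And>u. (u, v) \<in> A \<Longrightarrow> u \<notin> W"
    using assms(2) by (metis ex_in_conv wfE_min)
  then show ?thesis using assms(4) unfolding sources_def by blast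
qed

text \<open>No arc enters \<open>I\<close>, so after its first arc a path stays in \<open>U\<close>
  and uses only arcs of \<open>B\<close>; a cycle would therefore be a cycle of
  \<open>B\<close>.\<close>

lemma acyclic_Un_out_arcs:
  assumes "acyclic B" "B \<subseteq> U \<times> U" "C \<subseteq> I \<times> U" "I \<inter> U = {}"
  shows "acyclic (B \<union> C)"
proof (rule acyclicI, intro allI notI)
  have "y \<in> U \<and> (x \<in> U \<longrightarrow> (x, y) \<in> B\<^sup>+)" if "(x, y) \<in> (B \<union> C)\<^sup>+" for x y
    using that
  proof (induction rule: trancl_induct)
    case (base y)
    then show ?case using assms by blast
  next
    case (step y z)
    then have "(y, z) \<in> B" using assms by blast
    then show ?case using step.IH assms(2) by (auto intro: trancl_into_trancl)
  qed
  moreover fix x assume "(x, x) \<in> (B \<union> C)\<^sup>+"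
  ultimately show False
    using assms(1) unfolding acyclic_def by blast
qed

text \<open>There are no edges inside \<open>I\<close>, and prescribing \<open>I\<close> as sources
  forces the direction of every edge leaving \<open>I\<close>. Only the arcs inside the complement
  remain free.\<close>

lemma card_acyclic_orientations_sources:
  fixes G :: "'a ugraph"
  assumes edges: "\<Union> (snd G) \<subseteq> fst G" and "I \<subseteq> fst G" "indep G I"
  shows "card {A \<in> acyclic_orientations G. I \<subseteq> sources (fst G) A} = AO (induced G (fst G - I))"
proof -
  define U where "U = fst G - I"
  \<comment> \<open>The forced arcs; adding them back inverts the restriction to
    \<open>U\<close>.\<close>
  define C where "C = {(u, v). u \<in> I \<and> v \<in> U \<and> {u, v} \<in> snd G}"
  have "bij_betw (\<lambda>A. A \<inter> U \<times> U) {A \<in> acyclic_orientations G. I \<subseteq> sources (fst G) A}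
    (acyclic_orientations (induced G U))"
  proof (rule bij_betwI[where g = "\<lambda>B. B \<union> C"])
    show "(\<lambda>A. A \<inter> U \<times> U) \<in> {A \<in> acyclic_orientations G. I \<subseteq> sources (fst G) A} \<rightarrow>
        acyclic_orientations (induced G U)"
    proof
      fix A assume "A \<in> {A \<in> acyclic_orientations G. I \<subseteq> sources (fst G) A}"
      then have A: "A \<in> orientations G" "acyclic A"
        by (auto simp: acyclic_orientations_def)
      have "A \<inter> U \<times> U \<in> orientations (induced G U)"
        using A(1) unfolding orientations_def induced_def by auto
      moreover have "acyclic (A \<inter> U \<times> U)"
        using A(2) by (rule acyclic_subset) simp
      ultimately show "A \<inter> U \<times> U \<in> acyclic_orientations (induced G U)"
        by (simp add: acyclic_orientations_def)
    qed
  next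
    show "(\<lambda>B. B \<union> C) \<in> acyclic_orientations (induced G U) \<rightarrow>
        {A \<in> acyclic_orientations G. I \<subseteq> sources (fst G) A}"
    proof
      fix B assume B: "B \<in> acyclic_orientations (induced G U)"
      then have BU: "B \<subseteq> U \<times> U"
        using orientations_subset[of "induced G U" B]
        by (auto simp: induced_def acyclic_orientations_def)
      have "acyclic (B \<union> C)"
        by (rule acyclic_Un_out_arcs[OF _ BU, of _ I])
          (use B in \<open>auto simp: acyclic_orientations_def C_def U_def\<close>)
      moreover have "B \<union> C \<in> orientations G"
      proof -
        have "{u, v} \<in> snd G" if "(u, v) \<in> B \<union> C" for u v
          using that B unfolding acyclic_orientations_def orientations_def induced_def C_def by auto
        moreover have "(u, v) \<in> B \<union> C \<longleftrightarrow> (v, u) \<notin> B \<union> C" if e: "{u, v} \<in> snd G" for u v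
        proof -
          have uv: "u \<in> fst G" "v \<in> fst G" "{v, u} \<in> snd G"
            using e edges by (auto simp: insert_commute)
          \<comment> \<open>Both endpoints in \<open>I\<close> is impossible by
            independence.\<close>
          consider "u \<in> U" "v \<in> U" | "u \<in> I" "v \<in> U" | "u \<in> U" "v \<in> I"
            using uv e \<open>indep G I\<close> unfolding U_def indep_def by blast
          then show ?thesis
          proof cases
            case 1
            then have "(u, v) \<in> B \<longleftrightarrow> (v, u) \<notin> B"
              using B e unfolding acyclic_orientations_def orientations_def induced_def by auto
            then show ?thesis using 1 unfolding C_def U_def by auto
          qed (use e uv BU in \<open>auto simp: C_def U_def\<close>)
        qed
        ultimately show ?thesis unfolding orientations_def by auto
      qed
      moreover have "I \<subseteq> sources (fst G) (B \<union> C)"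
        using BU \<open>I \<subseteq> fst G\<close> unfolding sources_def C_def U_def by auto
      ultimately show "B \<union> C \<in> {A \<in> acyclic_orientations G. I \<subseteq> sources (fst G) A}"
        by (simp add: acyclic_orientations_def)
    qed
  next
    fix A assume A: "A \<in> {A \<in> acyclic_orientations G. I \<subseteq> sources (fst G) A}"
    then have o: "\<And>u v. (u, v) \<in> A \<Longrightarrow> {u, v} \<in> snd G"
      "\<And>u v. {u, v} \<in> snd G \<Longrightarrow> (u, v) \<in> A \<longleftrightarrow> (v, u) \<notin> A"
      and I: "\<And>u v. v \<in> I \<Longrightarrow> (u, v) \<notin> A"
      by (auto simp: acyclic_orientations_def orientations_def sources_def)
    show "A \<inter> U \<times> U \<union> C = A"
    proof
      show "A \<inter> U \<times> U \<union> C \<subseteq> A"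
        using o(2) I unfolding C_def by blast
      show "A \<subseteq> A \<inter> U \<times> U \<union> C"
      proof (rule subrelI)
        fix u v assume "(u, v) \<in> A"
        moreover from this have "{u, v} \<in> snd G" "v \<notin> I"
          using o(1) I by blast+
        moreover from this have "u \<in> fst G" "v \<in> fst G"
          using edges by auto
        ultimately show "(u, v) \<in> A \<inter> U \<times> U \<union> C"
          unfolding C_def U_def by auto
      qed
    qed
  next
    fix B assume B: "B \<in> acyclic_orientations (induced G U)"
    then have "B \<subseteq> U \<times> U"
      using orientations_subset[of "induced G U" B]
      by (auto simp: induced_def acyclic_orientations_def)
    then show "(B \<union> C) \<inter> U \<times> U = B"
      unfolding C_def U_def by auto
  qed
  then show ?thesis
    by (simp add: bij_betw_same_card AO_def acyclic_orientations_def U_def)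
qed

text \<open>Double counting of the pairs \<open>(I, A)\<close> with \<open>I\<close> contained in
  the sources of \<open>A\<close>, weighted by the sign of \<open>I\<close>: for fixed
  \<open>A\<close> the signs cancel, as \<open>A\<close> has a source.\<close>

lemma AO_source_recursion:
  fixes G :: "'a ugraph"
  assumes "finite (fst G)" "fst G \<noteq> {}" "\<Union> (snd G) \<subseteq> fst G"
  shows "(\<Sum>I | I \<subseteq> fst G \<and> indep G I. (- 1) ^ card I * real (AO (induced G (fst G - I)))) = 0"
proof -
  define X where "X = acyclic_orientations G"
  define T where "T = {I. I \<subseteq> fst G \<and> indep G I}"
  have X: "A \<subseteq> fst G \<times> fst G" "acyclic A" "A \<in> orientations G" if "A \<in> X" for A
    using that orientations_subset[OF assms(3)] by (auto simp: X_def acyclic_orientations_def)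
  have finX: "finite X"
    using X(1) assms(1) by (intro finite_subset[of X "Pow (fst G \<times> fst G)"]) auto
  have finT: "finite T"
    using assms(1) by (intro finite_subset[of T "Pow (fst G)"]) (auto simp: T_def)
  have "(\<Sum>I\<in>T. (- 1) ^ card I * real (AO (induced G (fst G - I))))
      = (\<Sum>I\<in>T. \<Sum>A | A \<in> X \<and> I \<subseteq> sources (fst G) A. (- 1) ^ card I)"
    using assms
    by (intro sum.cong refl)
      (simp add: T_def X_def card_acyclic_orientations_sources[symmetric])
  also have "\<dots> = (\<Sum>A\<in>X. \<Sum>I | I \<in> T \<and> I \<subseteq> sources (fst G) A. (- 1) ^ card I)"
    by (rule sum.swap_restrict[OF finT finX])
  \<comment> \<open>Every set of sources is automatically independent, so membership in
    \<open>T\<close> drops out.\<close>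
  also have "\<dots> = (\<Sum>A\<in>X. \<Sum>I\<in>Pow (sources (fst G) A). (- 1) ^ card I)"
    using indep_subset_sources[OF X(3)]
    by (intro sum.cong refl) (auto simp: T_def sources_def)
  also have "\<dots> = (\<Sum>A\<in>X. 0)"
  proof (intro sum.cong refl sum_Pow_alternating)
    fix A assume "A \<in> X"
    then show "sources (fst G) A \<noteq> {}"
      using X assms by (intro sources_nonempty) auto
    show "finite (sources (fst G) A)"
      using assms(1) by (auto simp: sources_def)
  qed
  finally show ?thesis by (simp add: T_def)
qed


subsection \<open>The polynomials and their derivatives\<close>

text \<open>The index \<open>j = 0\<close> only matters for \<open>m = 0\<close>, where it yields the empty-part value \<open>1\<close>,
  whereas \<^term>\<open>P 0 t = 0\<close>.\<close>

definition signed_touchard :: "nat \<Rightarrow> real poly" where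
  "signed_touchard m = (\<Sum>j\<le>m. monom ((- 1) ^ (m + j) * real (Stirling m j)) j)"

lemma coeff_signed_touchard:
  "coeff (signed_touchard m) j = (- 1) ^ (m + j) * real (Stirling m j)"
proof -
  have "coeff (signed_touchard m) j
      = (\<Sum>i\<le>m. if j = i then (- 1) ^ (m + i) * real (Stirling m i) else 0)"
    unfolding signed_touchard_def coeff_sum by (intro sum.cong) auto
  then show ?thesis by (cases "j \<le> m") auto
qed

lemma signed_touchard_0 [simp]: "signed_touchard 0 = 1"
  by (simp add: signed_touchard_def)

lemma poly_signed_touchard_0:
  assumes "m \<ge> 1"
  shows "poly (signed_touchard m) 0 = 0"
  using assms by (cases m) (simp_all add: poly_0_coeff_0 coeff_signed_touchard)

lemma poly_signed_touchard:
  assumes "m \<ge> 1"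
  shows "poly (signed_touchard m) t = P m t"
proof -
  have "poly (signed_touchard m) t = (\<Sum>j\<le>m. (- 1) ^ (m + j) * real (Stirling m j) * t ^ j)"
    by (simp add: signed_touchard_def poly_sum poly_monom)
  also have "\<dots> = P m t"
    unfolding P_def using assms
    \<comment> \<open>The extra term \<open>j = 0\<close> vanishes since
      \<open>Stirling m 0 = 0\<close> for positive \<open>m\<close>.\<close>
    by (cases m; intro sum.mono_neutral_right) (auto simp: Suc_le_eq)
  finally show ?thesis .
qed

text \<open>Both sides count partitions of an \<open>m\<close>-set into \<open>j + 1\<close> blocks
  with one block marked; \<open>i\<close> is the number of elements outside the marked block. The
  proof is by Pascal's rule and the Stirling recurrence.\<close>

lemma sum_choose_Stirling:
  "(\<Sum>i<m. (m choose i) * Stirling i j) = Suc j * Stirling m (Suc j)"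
proof (induction m arbitrary: j)
  case 0
  then show ?case by simp
next
  case (Suc m)
  have "(\<Sum>i<Suc m. (Suc m choose i) * Stirling i j)
      = Stirling 0 j + (\<Sum>i<m. (m choose i) * Stirling (Suc i) j)
        + (\<Sum>i<m. (m choose Suc i) * Stirling (Suc i) j)"
    by (subst sum.lessThan_Suc_shift) (simp add: algebra_simps sum.distrib)
  \<comment> \<open>The separated term \<open>i = 0\<close> is absorbed as the first term of the sum
    with \<open>m choose Suc i\<close>.\<close>
  also have "\<dots> = (\<Sum>i<Suc m. (m choose i) * Stirling i j)
        + (\<Sum>i<m. (m choose i) * Stirling (Suc i) j)"
    by (simp add: sum.lessThan_Suc_shift del: sum.lessThan_Suc)
  also have "\<dots> = Suc j * Stirling (Suc m) (Suc j)"
  \<comment> \<open>For \<open>j = 0\<close> the second sum is zero; otherwise the Stirling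
    recurrence splits it into the cases \<open>j\<close> and \<open>j - 1\<close> of the induction
    hypothesis.\<close>
  proof (cases j)
    case 0
    then show ?thesis using Suc.IH[of 0] by simp
  next
    case (Suc k)
    have "(\<Sum>i<m. (m choose i) * Stirling (Suc i) j)
        = j * (\<Sum>i<m. (m choose i) * Stirling i j) + (\<Sum>i<m. (m choose i) * Stirling i k)"
      by (simp add: Suc algebra_simps sum.distrib sum_distrib_left)
    then show ?thesis using Suc.IH[of j] Suc.IH[of k]
      by (simp add: Suc algebra_simps)
  qed
  finally show ?case .
qed

text \<open>Up to a common sign, comparing coefficients of \<open>t ^ j\<close> gives exactly
  \<open>sum_choose_Stirling\<close>.\<close>

lemma pderiv_signed_touchard:
  "pderiv (signed_touchard m)
    = (\<Sum>i<m. smult (- ((- 1) ^ (m - i) * real (m choose i))) (signed_touchard i))"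
proof (rule poly_eqI)
  fix j
  have "coeff (\<Sum>i<m. smult (- ((- 1) ^ (m - i) * real (m choose i))) (signed_touchard i)) j
      = (\<Sum>i<m. - ((- 1) ^ (m + j)) * real ((m choose i) * Stirling i j))"
    unfolding coeff_sum
  proof (intro sum.cong refl)
    fix i assume "i \<in> {..<m}"
    then obtain d where "m = i + d" by (metis lessThan_iff less_imp_add_positive)
    then show "coeff (smult (- ((- 1) ^ (m - i) * real (m choose i))) (signed_touchard i)) j
        = - ((- 1) ^ (m + j)) * real ((m choose i) * Stirling i j)"
      by (simp add: coeff_signed_touchard power_add)
  qed
  also have "\<dots> = - ((- 1) ^ (m + j)) * real (\<Sum>i<m. (m choose i) * Stirling i j)"
    by (simp add: sum_distrib_left)
  also have "\<dots> = coeff (pderiv (signed_touchard m)) j"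
    by (simp add: sum_choose_Stirling coeff_pderiv coeff_signed_touchard algebra_simps)
  finally show "coeff (pderiv (signed_touchard m)) j
      = coeff (\<Sum>i<m. smult (- ((- 1) ^ (m - i) * real (m choose i))) (signed_touchard i)) j" ..
qed

text \<open>The derivative as a sum over nonempty subsets, matching the independent sets inside one
  part in the source recursion.\<close>

lemma pderiv_signed_touchard_card:
  assumes "finite S"
  shows "pderiv (signed_touchard (card S))
    = - (\<Sum>I\<in>Pow S - {{}}. smult ((- 1) ^ card I) (signed_touchard (card (S - I))))"
proof -
  define m where "m = card S"
  define g where "g i = smult ((- 1) ^ (m - i)) (signed_touchard i)" for i
  have "(\<Sum>I\<in>Pow S. smult ((- 1) ^ card I) (signed_touchard (card (S - I))))
      = (\<Sum>J\<in>Pow S. g (card J))"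
  proof (rule sum.reindex_bij_witness[where i = "\<lambda>J. S - J" and j = "\<lambda>I. S - I"])
    fix I assume "I \<in> Pow S"
    then have "card I \<le> m" "card (S - I) = m - card I"
      using assms by (auto simp: m_def card_mono card_Diff_subset finite_subset)
    then show "g (card (S - I)) = smult ((- 1) ^ card I) (signed_touchard (card (S - I)))"
      by (simp add: g_def)
  qed auto
  also have "\<dots> = (\<Sum>i\<le>m. of_nat (m choose i) * g i)"
    unfolding m_def by (rule sum_Pow_card[OF assms])
  \<comment> \<open>The index \<open>i = m\<close> corresponds to \<open>I = {}\<close>.\<close>
  also have "\<dots> = signed_touchard m + (\<Sum>i<m. of_nat (m choose i) * g i)"
    by (simp add: lessThan_Suc_atMost[symmetric] g_def)
  also have "(\<Sum>i<m. of_nat (m choose i) * g i) = - pderiv (signed_touchard m)"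
    unfolding pderiv_signed_touchard sum_negf[symmetric]
    by (intro sum.cong) (simp_all add: g_def of_nat_poly mult.commute)
  finally show ?thesis
    using assms by (simp add: sum_diff1 m_def)
qed


subsection \<open>The Laplace functional\<close>

text \<open>The linear functional sending \<open>t ^ n\<close> to \<open>n!\<close>, an algebraic
  stand-in for integration against \<open>exp (- t)\<close>.\<close>

definition factorial_functional :: "real poly \<Rightarrow> real" where
  "factorial_functional p = (\<Sum>n\<le>degree p. coeff p n * fact n)"

lemma factorial_functional_eq:
  assumes "degree p \<le> N"
  shows "factorial_functional p = (\<Sum>n\<le>N. coeff p n * fact n)"
  unfolding factorial_functional_def using assms
  by (intro sum.mono_neutral_left) (auto simp: coeff_eq_0)

lemma factorial_functional_0 [simp]: "factorial_functional 0 = 0"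
  by (simp add: factorial_functional_def)

lemma factorial_functional_1 [simp]: "factorial_functional 1 = 1"
  by (simp add: factorial_functional_def)

lemma factorial_functional_add:
  "factorial_functional (p + q) = factorial_functional p + factorial_functional q"
proof -
  define N where "N = max (degree p) (degree q)"
  have "degree p \<le> N" "degree q \<le> N" "degree (p + q) \<le> N"
    by (auto simp: N_def degree_add_le_max)
  then show ?thesis
    by (simp add: factorial_functional_eq[of _ N] algebra_simps sum.distrib)
qed

lemma factorial_functional_smult:
  "factorial_functional (smult c p) = c * factorial_functional p"
  by (simp add: factorial_functional_eq[OF degree_smult_le] factorial_functional_def
      sum_distrib_left mult.assoc)

lemma factorial_functional_sum:
  "factorial_functional (sum f A) = (\<Sum>x\<in>A. factorial_functional (f x))"
  by (induction A rule: infinite_finite_induct) (auto simp: factorial_functional_add)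

text \<open>Integration by parts in algebraic form; on monomials it is
  \<open>(n + 1)! = (n + 1) * n!\<close>.\<close>

lemma factorial_functional_pderiv:
  "factorial_functional p = poly p 0 + factorial_functional (pderiv p)"
proof -
  \<comment> \<open>One index beyond the degree, so that after the shift the sum runs up to
    \<open>degree p\<close>.\<close>
  have "factorial_functional p = (\<Sum>n\<le>Suc (degree p). coeff p n * fact n)"
    by (rule factorial_functional_eq) simp
  also have "\<dots> = poly p 0 + (\<Sum>n\<le>degree p. coeff (pderiv p) n * fact n)"
    by (subst sum.atMost_Suc_shift) (simp add: poly_0_coeff_0 coeff_pderiv algebra_simps)
  also have "(\<Sum>n\<le>degree p. coeff (pderiv p) n * fact n) = factorial_functional (pderiv p)"
    by (rule factorial_functional_eq[symmetric]) (simp add: degree_pderiv)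
  finally show ?thesis .
qed

lemma has_integral_power_exp:
  "((\<lambda>t::real. exp (- t) * t ^ n) has_integral fact n) {0..}"
proof -
  have "((\<lambda>t. t powr (real (Suc n) - 1) / exp t) has_integral Gamma (real (Suc n))) {0..}"
    by (rule Gamma_integral_real) simp
  moreover have "Gamma (real (Suc n)) = fact n"
    using Gamma_fact[of n, where 'a = real] by (simp add: add.commute)
  ultimately have "((\<lambda>t. t powr real n / exp t) has_integral fact n) {0..}" by simp
  then show ?thesis
    \<comment> \<open>The integrands differ at 0 when \<open>n = 0\<close>, because
      \<open>0 powr 0 = 0\<close> while \<open>0 ^ 0 = 1\<close>.\<close>
    by (rule has_integral_spike[where S = "{0}", rotated 2])
      (auto simp: powr_realpow exp_minus divide_simps)
qed

lemma has_integral_poly_exp: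
  "((\<lambda>t. exp (- t) * poly p t) has_integral factorial_functional p) {0..}"
proof -
  have "((\<lambda>t. \<Sum>n\<le>degree p. coeff p n * (exp (- t) * t ^ n)) has_integral
      (\<Sum>n\<le>degree p. coeff p n * fact n)) {0..}"
    by (intro has_integral_sum has_integral_mult_right has_integral_power_exp) simp
  then show ?thesis
    by (simp add: factorial_functional_def poly_altdef sum_distrib_left mult_ac)
qed


subsection \<open>Complete multipartite graphs\<close>

text \<open>The parts are the fibres of \<open>f\<close> on \<open>W\<close>. With \<open>f\<close>
  fixed, this family is closed under deleting vertices, as the induction requires.\<close>

definition multipartite_on :: "('a \<Rightarrow> 'b) \<Rightarrow> 'a set \<Rightarrow> 'a ugraph" where
  "multipartite_on f W = (W, {{u, v} | u v. u \<in> W \<and> v \<in> W \<and> f u \<noteq> f v})"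

lemma fst_multipartite_on [simp]: "fst (multipartite_on f W) = W"
  by (simp add: multipartite_on_def)

lemma edges_multipartite_on: "\<Union> (snd (multipartite_on f W)) \<subseteq> W"
  by (auto simp: multipartite_on_def)

lemma induced_multipartite_on:
  assumes "U \<subseteq> W"
  shows "induced (multipartite_on f W) U = multipartite_on f U"
  using assms unfolding induced_def multipartite_on_def by auto

lemma indep_multipartite_on:
  assumes "I \<subseteq> W"
  shows "indep (multipartite_on f W) I \<longleftrightarrow> (\<forall>u\<in>I. \<forall>v\<in>I. f u = f v)"
  using assms unfolding indep_def multipartite_on_def by (fastforce simp: doubleton_eq_iff)

lemma AO_no_edges: "AO (V, {}) = 1"
proof -
  have "{A \<in> orientations (V, {}). acyclic A} = {{}}"
    by (auto simp: orientations_def acyclic_def)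
  then show ?thesis by (simp add: AO_def)
qed

text \<open>Induction on \<open>W\<close>, since both sides satisfy the same recursion.
  \<open>N\<close> may index empty fibres: a part emptied by deletions just contributes the factor
  \<open>signed_touchard 0 = 1\<close>.\<close>

lemma AO_multipartite_on:
  fixes f :: "'a \<Rightarrow> 'b"
  assumes "finite N" "finite W" "f ` W \<subseteq> N"
  shows "real (AO (multipartite_on f W))
    = factorial_functional (\<Prod>i\<in>N. signed_touchard (card {w \<in> W. f w = i}))"
  using assms(2,3)
proof (induction W rule: finite_psubset_induct)
  case (psubset W)
  define c where "c U = real (AO (multipartite_on f U))" for U
  define part where "part U i = {w \<in> U. f w = i}" for U i
  define F where "F U = (\<Prod>i\<in>N. signed_touchard (card (part U i)))" for U
  have fin: "finite (part W i)" for i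
    using psubset.hyps by (simp add: part_def)
  show ?case
  proof (cases "W = {}")
    case True
    then show ?thesis by (simp add: multipartite_on_def AO_no_edges)
  next
    case False
    \<comment> \<open>The empty set lies in every part, so it is split off to make the union
      disjoint.\<close>
    have indeps: "{I. I \<subseteq> W \<and> indep (multipartite_on f W) I}
        = insert {} (\<Union>i\<in>N. Pow (part W i) - {{}})"
    proof (intro set_eqI iffI)
      fix I assume "I \<in> {I. I \<subseteq> W \<and> indep (multipartite_on f W) I}"
      then have I: "I \<subseteq> W" "\<And>u v. u \<in> I \<Longrightarrow> v \<in> I \<Longrightarrow> f u = f v"
        using indep_multipartite_on[of I W f] by blast+
      show "I \<in> insert {} (\<Union>i\<in>N. Pow (part W i) - {{}})"
      proof (cases "I = {}")
        case False
        then obtain u where u: "u \<in> I" by auto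
        have "f u \<in> N"
          using u I(1) psubset.prems by blast
        moreover have "I \<subseteq> part W (f u)"
          unfolding part_def using u I by blast
        ultimately show ?thesis using False by blast
      qed simp
    next
      fix I assume "I \<in> insert {} (\<Union>i\<in>N. Pow (part W i) - {{}})"
      then have "I \<subseteq> W" "\<forall>u\<in>I. \<forall>v\<in>I. f u = f v"
        unfolding part_def by blast+
      then show "I \<in> {I. I \<subseteq> W \<and> indep (multipartite_on f W) I}"
        using indep_multipartite_on[of I W f] by blast
    qed
    \<comment> \<open>Deleting \<open>I\<close> from part \<open>i\<close> changes only the factor
      at \<open>i\<close> in the induction hypothesis.\<close>
    have step: "(- 1) ^ card I * c (W - I) = factorial_functional
        (smult ((- 1) ^ card I) (signed_touchard (card (part W i - I)))
          * (\<Prod>j\<in>N - {i}. signed_touchard (card (part W j))))"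
      if "i \<in> N" "I \<in> Pow (part W i) - {{}}" for i I
    proof -
      have "W - I \<subset> W"
        using that by (auto simp: part_def)
      then have "c (W - I) = factorial_functional (F (W - I))"
        using psubset.IH[of "W - I"] psubset.prems by (auto simp: c_def F_def part_def)
      also have "F (W - I) = signed_touchard (card (part W i - I))
          * (\<Prod>j\<in>N - {i}. signed_touchard (card (part W j)))"
      proof -
        have "part (W - I) i = part W i - I" by (auto simp: part_def)
        moreover have "part (W - I) j = part W j" if "j \<noteq> i" for j
          using that \<open>I \<in> Pow (part W i) - {{}}\<close> by (auto simp: part_def)
        ultimately show ?thesis
          unfolding F_def by (simp add: prod.remove[OF \<open>finite N\<close> \<open>i \<in> N\<close>])
      qed
      finally show ?thesis by (simp add: factorial_functional_smult)
    qed
    have "0 = (\<Sum>I | I \<subseteq> W \<and> indep (multipartite_on f W) I. (- 1) ^ card I * c (W - I))"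
      using AO_source_recursion[of "multipartite_on f W"] psubset.hyps False
        edges_multipartite_on[of f W]
      by (simp add: c_def induced_multipartite_on)
    also have "\<dots> = c W + (\<Sum>I\<in>(\<Union>i\<in>N. Pow (part W i) - {{}}). (- 1) ^ card I * c (W - I))"
      unfolding indeps using \<open>finite N\<close> fin by (subst sum.insert) auto
    also have "(\<Sum>I\<in>(\<Union>i\<in>N. Pow (part W i) - {{}}). (- 1) ^ card I * c (W - I))
        = (\<Sum>i\<in>N. \<Sum>I\<in>Pow (part W i) - {{}}. (- 1) ^ card I * c (W - I))"
    proof (rule sum.UNION_disjoint[OF \<open>finite N\<close>])
      show "\<forall>i\<in>N. finite (Pow (part W i) - {{}})" using fin by simp
      show "\<forall>i\<in>N. \<forall>j\<in>N. i \<noteq> j \<longrightarrow> (Pow (part W i) - {{}}) \<inter> (Pow (part W j) - {{}}) = {}"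
        by (auto simp: part_def)
    qed
    also have "\<dots> = (\<Sum>i\<in>N. factorial_functional
        ((\<Sum>I\<in>Pow (part W i) - {{}}. smult ((- 1) ^ card I) (signed_touchard (card (part W i - I))))
          * (\<Prod>j\<in>N - {i}. signed_touchard (card (part W j)))))"
      by (intro sum.cong refl)
        (simp add: step sum_distrib_right factorial_functional_sum del: Diff_iff mult_smult_left)
    also have "\<dots> = - factorial_functional (pderiv (F W))"
    proof -
      \<comment> \<open>The product rule, with each derivative expanded over the nonempty subsets of
        its part.\<close>
      have "pderiv (F W) = (\<Sum>i\<in>N. smult (- 1)
        ((\<Sum>I\<in>Pow (part W i) - {{}}. smult ((- 1) ^ card I) (signed_touchard (card (part W i - I))))
          * (\<Prod>j\<in>N - {i}. signed_touchard (card (part W j)))))"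
        unfolding F_def pderiv_prod
        by (intro sum.cong refl) (simp add: pderiv_signed_touchard_card[OF fin] mult.commute)
      then show ?thesis
        by (simp only: factorial_functional_sum factorial_functional_smult flip: sum_distrib_left)
    qed
    finally have "c W = factorial_functional (pderiv (F W))" by simp
    \<comment> \<open>The boundary term of the integration by parts: a nonempty part gives a factor
      vanishing at 0.\<close>
    moreover have "poly (F W) 0 = 0"
    proof -
      obtain w where w: "w \<in> W" using False by auto
      then have "card (part W (f w)) \<ge> 1"
        using fin by (auto simp: Suc_le_eq card_gt_0_iff part_def)
      then show ?thesis
        using w psubset.prems \<open>finite N\<close> poly_signed_touchard_0
        unfolding F_def poly_prod by (intro prod_zero) auto
    qed
    ultimately have "c W = factorial_functional (F W)"
      by (simp add: factorial_functional_pderiv[of "F W"])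
    then show ?thesis by (simp add: c_def F_def part_def)
  qed
qed

theorem proposition1:
  fixes r :: nat and lam :: "nat \<Rightarrow> nat"
  assumes "r \<ge> 1"
    and "\<And>i. i \<in> {1..r} \<Longrightarrow> lam i \<ge> 1"
  shows "((\<lambda>t. exp (- t) * (\<Prod>i = 1..r. P (lam i) t)) has_integral
           real (AO (complete_multipartite r lam))) {0..}"
proof -
  define V where "V = multipartite_verts r lam"
  have "card {w \<in> V. fst w = i} = lam i" if "i \<in> {1..r}" for i
  proof -
    have "{w \<in> V. fst w = i} = {i} \<times> {1..lam i}"
      using that by (auto simp: V_def multipartite_verts_def)
    then show ?thesis by (simp add: card_cartesian_product)
  qed
  moreover have "complete_multipartite r lam = multipartite_on fst V"
    by (simp add: complete_multipartite_def multipartite_on_def V_def)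
  ultimately have "real (AO (complete_multipartite r lam))
      = factorial_functional (\<Prod>i = 1..r. signed_touchard (lam i))"
    using AO_multipartite_on[of "{1..r}" V fst] by (simp add: V_def multipartite_verts_def image_subset_iff)
  \<comment> \<open>Positivity of the part sizes enters here: \<open>P\<close> and
    \<open>signed_touchard\<close> differ at index 0.\<close>
  moreover have "(\<Prod>i = 1..r. P (lam i) t) = poly (\<Prod>i = 1..r. signed_touchard (lam i)) t" for t
    unfolding poly_prod using assms(2) by (intro prod.cong) (simp_all add: poly_signed_touchard)
  ultimately show ?thesis
    using has_integral_poly_exp by simp
qed

end
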